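(* Let $a,b>0$ and $\alpha,\gamma\ge 0$, and for a scale variable $S>0$ let $I(S)=aS^\alpha$, $D(S)=bS^\gamma$ and $R(S)=I(S)/D(S)$. Assume there exists a monotone function $\Psi$ such that the excess loss satisfies $\mathcal{L}(S)-\mathcal{L}_\infty = \Psi(R(S))$, and that $\Psi$ has the asymptotic form $\Psi(r)\asymp r^{-q}$ (as $r\to\infty$) for some $q>0$. If $\alpha>\gamma$, then the excess loss satisfies $$\mathcal{L}(S)-\mathcal{L}_\infty \asymp S^{-q(\alpha-\gamma)} \qquad (S\to\infty).$$ In particular, when $q=1/2$, $$\mathcal{L}(S)-\mathcal{L}_\infty \asymp S^{-(\alpha-\gamma)/2}.$$
   Context: $S$ is a scale variable (such as dataset size, model size or compute budget); $I(S)$ and $D(S)$ are the scale-dependent information-injection and entropy-dissipation rates; $R(S)$ is the effective information ratio; $\mathcal{L}(S)$ is the loss at scale $S$ and $\mathcal{L}_\infty$ a real constant (limiting loss). $f\asymp g$ means there are constants $0<c\le C<\infty$ with $c\,g\le f\le C\,g$ asymptotically (for all sufficiently large arguments). *)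

theory Defs
  imports Complex_Main
begin

text \<open>Two-sided comparison as the argument tends to infinity. Unlike membership in the library's
  Landau class \<open>\<Theta>\<close>, which compares norms, the bounds here are on the signed values.\<close>

definition same_order :: "(real \<Rightarrow> real) \<Rightarrow> (real \<Rightarrow> real) \<Rightarrow> bool"  (infix \<open>\<asymp>\<close> 50) where
  "f \<asymp> g \<longleftrightarrow> (\<exists>c C. 0 < c \<and> c \<le> C \<and> (\<forall>\<^sub>F x in at_top. c * g x \<le> f x \<and> f x \<le> C * g x))"

end

theory Submission
  imports Defs
begin

text \<open>With \<open>k = a / b\<close> and \<open>d = \<alpha> - \<gamma>\<close>, both positive,
  the ratio \<open>R S\<close> is the pure power \<open>k * S powr d\<close>, which tends to
  infinity with \<open>S\<close>. The behaviour of \<Psi> at infinity can therefore be pulled back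
  along \<open>R\<close> (\<open>filterlim_mult_powr_at_top\<close>,
  \<open>same_order_compose\<close>). This yields \<open>(k * S powr d) powr (- q)\<close>, a
  constant multiple of \<open>S powr (- q * d)\<close>, and the constant disappears into the
  comparison constants (\<open>same_order_scale_right\<close>).\<close>

text \<open>Once \<open>h x\<close> has passed the threshold beyond which the bounds hold, they hold
  at \<open>h x\<close> with the same constants.\<close>

lemma same_order_compose:
  assumes "f \<asymp> g" and "filterlim h at_top at_top"
  shows "(\<lambda>x. f (h x)) \<asymp> (\<lambda>x. g (h x))"
  using assms unfolding same_order_def by (blast dest: eventually_compose_filterlim)

text \<open>The factor moves into the witnesses, \<open>c * k\<close> and \<open>C * k\<close>;
  positivity of \<open>k\<close> keeps them positive and in order.\<close>

lemma same_order_scale_right: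
  assumes "f \<asymp> (\<lambda>x. k * g x)" and "k > 0"
  shows "f \<asymp> g"
proof -
  obtain c C where c: "0 < c" "c \<le> C"
    and ev: "\<forall>\<^sub>F x in at_top. c * (k * g x) \<le> f x \<and> f x \<le> C * (k * g x)"
    using assms(1) unfolding same_order_def by blast
  have "\<forall>\<^sub>F x in at_top. (c * k) * g x \<le> f x \<and> f x \<le> (C * k) * g x"
    using ev by (simp only: mult.assoc)
  moreover have "0 < c * k" "c * k \<le> C * k"
    using c \<open>k > 0\<close> by simp_all
  ultimately show ?thesis
    unfolding same_order_def by blast
qed

text \<open>Only behaviour near infinity matters to \<asymp>. Eventual equality is the right form
  here, since the formulas for the rates and the loss are given only for
  \<open>S > 0\<close>.\<close>

lemma same_order_cong:
  assumes "f \<asymp> g"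
    and "\<forall>\<^sub>F x in at_top. f x = f' x" and "\<forall>\<^sub>F x in at_top. g x = g' x"
  shows "f' \<asymp> g'"
proof -
  obtain c C where c: "0 < c" "c \<le> C"
    and ev: "\<forall>\<^sub>F x in at_top. c * g x \<le> f x \<and> f x \<le> C * g x"
    using assms(1) unfolding same_order_def by blast
  have "\<forall>\<^sub>F x in at_top. c * g' x \<le> f' x \<and> f' x \<le> C * g' x"
    using ev assms(2,3) by eventually_elim simp
  with c show ?thesis
    unfolding same_order_def by blast
qed

lemma filterlim_mult_powr_at_top:
  fixes k d :: real
  assumes "k > 0" and "d > 0"
  shows "filterlim (\<lambda>x. k * x powr d) at_top at_top"
proof (rule filterlim_tendsto_pos_mult_at_top[OF tendsto_const \<open>k > 0\<close>])
  have "filterlim (\<lambda>x::real. exp (d * ln x)) at_top at_top"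
    by (rule filterlim_compose[OF exp_at_top]
        filterlim_tendsto_pos_mult_at_top[OF tendsto_const \<open>d > 0\<close>] ln_at_top)+
  \<comment> \<open>The exponential form fails at base 0, where \<open>powr\<close> is 0 by
    convention, so the equality is asserted only eventually.\<close>
  moreover have "\<forall>\<^sub>F x::real in at_top. exp (d * ln x) = x powr d"
    using eventually_gt_at_top[of 0] by eventually_elim (simp add: powr_def)
  ultimately show "filterlim (\<lambda>x::real. x powr d) at_top at_top"
    by (simp add: filterlim_cong[OF refl refl])
qed

theorem proposition4:
  fixes a b \<alpha> \<gamma> q L_inf :: real
    and I D R L :: "real \<Rightarrow> real"
  assumes "a > 0" and "b > 0" and "\<alpha> \<ge> 0" and "\<gamma> \<ge> 0"
    and "\<And>S. S > 0 \<Longrightarrow> I S = a * S powr \<alpha>"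
    and "\<And>S. S > 0 \<Longrightarrow> D S = b * S powr \<gamma>"
    and "\<And>S. S > 0 \<Longrightarrow> R S = I S / D S"
    and "q > 0"
    and "\<exists>\<Psi> :: real \<Rightarrow> real.
           (mono_on {0<..} \<Psi> \<or> antimono_on {0<..} \<Psi>) \<and>
           (\<forall>S>0. L S - L_inf = \<Psi> (R S)) \<and>
           \<Psi> \<asymp> (\<lambda>r. r powr (- q))"
    and "\<alpha> > \<gamma>"
  shows "(\<lambda>S. L S - L_inf) \<asymp> (\<lambda>S. S powr (- q * (\<alpha> - \<gamma>))) \<and>
         (q = 1 / 2 \<longrightarrow> (\<lambda>S. L S - L_inf) \<asymp> (\<lambda>S. S powr (- (\<alpha> - \<gamma>) / 2)))"
proof -
  define k d where "k = a / b" and "d = \<alpha> - \<gamma>"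
  have k: "k > 0" and d: "d > 0"
    using assms by (simp_all add: k_def d_def)
  obtain \<Psi> where loss: "\<And>S. S > 0 \<Longrightarrow> L S - L_inf = \<Psi> (R S)"
    and \<Psi>: "\<Psi> \<asymp> (\<lambda>r. r powr (- q))"
    using assms(9) by blast
  have R: "R S = k * S powr d" if "S > 0" for S
    using that assms(5-7) by (simp add: k_def d_def powr_diff)
  have "(\<lambda>S. \<Psi> (k * S powr d)) \<asymp> (\<lambda>S. (k * S powr d) powr (- q))"
    by (rule same_order_compose[OF \<Psi> filterlim_mult_powr_at_top[OF k d]])
  moreover have "\<forall>\<^sub>F S in at_top. \<Psi> (k * S powr d) = L S - L_inf"
    using eventually_gt_at_top[of 0] by eventually_elim (simp add: loss R)
  moreover have "\<forall>\<^sub>F S in at_top. (k * S powr d) powr (- q) = k powr (- q) * S powr (- q * d)"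
    using eventually_gt_at_top[of 0]
    by eventually_elim (use k in \<open>simp add: powr_mult powr_powr mult.commute\<close>)
  ultimately have "(\<lambda>S. L S - L_inf) \<asymp> (\<lambda>S. k powr (- q) * S powr (- q * d))"
    by (rule same_order_cong)
  then have "(\<lambda>S. L S - L_inf) \<asymp> (\<lambda>S. S powr (- q * (\<alpha> - \<gamma>)))"
    unfolding d_def by (rule same_order_scale_right) (use k in simp)
  \<comment> \<open>The special case is the general rate with its exponent rewritten.\<close>
  moreover have "- q * (\<alpha> - \<gamma>) = - (\<alpha> - \<gamma>) / 2" if "q = 1 / 2"
    unfolding that by (simp add: field_simps)
  ultimately show ?thesis
    by metis
qed

end
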